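(* Let $0<\underline\delta<1$, let $t_\circ\in[0,T)$, and let $(x_{\ell,\circ},x_\circ,v_{\ell,\circ},v_\circ)$ lie in the interior of $\Xi^{(\underline\delta)}$. Let $(x_\ell,x,v_\ell,v)$ be the solution of $$\dot x_\ell=v_\ell,\quad \dot v_\ell=\mathsf a_\ell,\quad \dot x=v,\quad \dot v=\mathcal A(x_\ell,x,v_\ell,v;u)$$ starting at time $t_\circ$ from $(x_{\ell,\circ},x_\circ,v_{\ell,\circ},v_\circ)$, and let $$\tau^{(\underline\delta)}=\inf\{t>t_\circ:\ (x_\ell(t),x(t),v_\ell(t),v(t))\in\partial\Xi^{(\underline\delta)}\}$$ be the first time it reaches the boundary of $\Xi^{(\underline\delta)}$. Then the set $$\mathcal N=\{(x_\ell,x,v_\ell,v):\ x_\ell-x\in[\underline\delta,1/\underline\delta],\ v\in(0,\bar v)\}$$ is invariant along this trajectory up to time $\tau^{(\underline\delta)}$: for every $t\in[t_\circ,T]$ with $t\le\tau^{(\underline\delta)}$ one has $x_\ell(t)-x(t)\in[\underline\delta,1/\underline\delta]$ and $v(t)\in(0,\bar v)$.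
   Context: Fixed data: constants $k_v,k_d,k,\tau_s>0$; constants $0<\underline u<\bar u<\bar v<\infty$; a time horizon $T>0$; a control $u\in C([0,T];[\underline u,\bar u])$; a leader acceleration $\mathsf a_\ell\in C([0,T];\mathbb R)\cap L^\infty([0,T];\mathbb R)$ such that $0\le v_{\ell,\circ}+\int_{t_\circ}^t\mathsf a_\ell(s)\,ds\le\bar v$ for all $t\in[t_\circ,T]$. The acceleration of the following vehicle is $$\mathcal A(x_\ell,x,v_\ell,v;u)=\min\Bigl\{k_v\frac{v_\ell-v}{(x_\ell-x)^2}+k_d(x_\ell-x-\tau_s v),\;k(u-v)\Bigr\},$$ where $u=u(t)$ is evaluated at the current time. The compact set $\Xi^{(\underline\delta)}$ is $$\Xi^{(\underline\delta)}=\{(x_1,x_2,v_1,v_2)\in\mathbb R^2\times\mathbb R_+^2:\ x_1-x_2\in[\underline\delta,1/\underline\delta],\ x_2\in[-1/\underline\delta,1/\underline\delta],\ v_1,v_2\in[0,\bar v]\},$$ and its interior and boundary are taken in $\mathbb R^4$. Convention: $\inf\emptyset=+\infty$. The solution (in the integral sense) exists uniquely, with values in $\Xi^{(\underline\delta)}$, for $t\in[t_\circ,T]$ with $t\le\tau^{(\underline\delta)}$. *)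

theory Defs
  imports "HOL-Analysis.Analysis"
begin

text \<open>
  States are quadruples (leader position, follower position, leader velocity, follower velocity),
  i.e. points of the product space \<open>real \<times> real \<times> real \<times> real\<close>, whose topology is that of
  Euclidean 4-space.
\<close>

type_synonym state = "real \<times> real \<times> real \<times> real"

text \<open>The last argument is the current value of the control.\<close>

definition acc :: "real \<Rightarrow> real \<Rightarrow> real \<Rightarrow> real \<Rightarrow> real \<Rightarrow> real \<Rightarrow> real \<Rightarrow> real \<Rightarrow> real \<Rightarrow> real" where
  "acc kv kd k \<tau>s xl x vl v u =
     min (kv * ((vl - v) / (xl - x)\<^sup>2) + kd * (xl - x - \<tau>s * v)) (k * (u - v))"

definition Xi :: "real \<Rightarrow> real \<Rightarrow> state set" where
  "Xi vbar \<delta> = {(x1, x2, v1, v2).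
     0 \<le> v1 \<and> 0 \<le> v2 \<and>
     x1 - x2 \<in> {\<delta>..1/\<delta>} \<and> x2 \<in> {-1/\<delta>..1/\<delta>} \<and> v1 \<in> {0..vbar} \<and> v2 \<in> {0..vbar}}"

definition Ninv :: "real \<Rightarrow> real \<Rightarrow> state set" where
  "Ninv vbar \<delta> = {(xl, x, vl, v). xl - x \<in> {\<delta>..1/\<delta>} \<and> v \<in> {0<..<vbar}}"

text \<open>
  First time after \<open>t0\<close>, within the horizon \<open>T\<close>, at which the curve \<open>z\<close> is on the topological
  boundary of \<open>Xi vbar \<delta>\<close>. In \<open>ereal\<close> the infimum of the empty set is \<open>\<infinity>\<close>.
\<close>

definition exit_time :: "real \<Rightarrow> real \<Rightarrow> real \<Rightarrow> real \<Rightarrow> (real \<Rightarrow> state) \<Rightarrow> ereal" where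
  "exit_time vbar \<delta> t0 T z = Inf (ereal ` {t. t0 < t \<and> t \<le> T \<and> z t \<in> frontier (Xi vbar \<delta>)})"

text \<open>
  Solution in the integral sense on a time set \<open>I\<close> (an interval with left end point \<open>t0\<close>):
  continuous functions satisfying the integrated equations. Values outside \<open>I\<close> are irrelevant.
\<close>

definition integral_solution_on ::
  "real \<Rightarrow> real \<Rightarrow> real \<Rightarrow> real \<Rightarrow> (real \<Rightarrow> real) \<Rightarrow> (real \<Rightarrow> real) \<Rightarrow> real set \<Rightarrow> real \<Rightarrow> state \<Rightarrow>
   (real \<Rightarrow> real) \<Rightarrow> (real \<Rightarrow> real) \<Rightarrow> (real \<Rightarrow> real) \<Rightarrow> (real \<Rightarrow> real) \<Rightarrow> bool" where
  "integral_solution_on kv kd k \<tau>s u al I t0 z0 xl x vl v \<longleftrightarrow>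
     (case z0 of (xl0, x0, vl0, v0) \<Rightarrow>
       continuous_on I xl \<and> continuous_on I x \<and> continuous_on I vl \<and> continuous_on I v \<and>
       (\<forall>t\<in>I.
          (vl has_integral (xl t - xl0)) {t0..t} \<and>
          (al has_integral (vl t - vl0)) {t0..t} \<and>
          (v has_integral (x t - x0)) {t0..t} \<and>
          ((\<lambda>s. acc kv kd k \<tau>s (xl s) (x s) (vl s) (v s) (u s)) has_integral (v t - v0)) {t0..t}))"

end

theory Submission
  imports Defs
begin

text \<open>
  Before the exit time the trajectory cannot leave the interior of \<open>Xi\<close>, since a connected curve
  leaving a set crosses its frontier (\<open>interior_before_exit\<close>); there the follower's velocity lies
  strictly between \<open>0\<close> and \<open>vbar\<close> (\<open>interior_Xi_velocity\<close>). By closedness of \<open>Xi\<close> the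
  point reached at the exit time is still in \<open>Xi\<close>, so the only possible failure is that the
  velocity equals \<open>0\<close> or \<open>vbar\<close> at the exit time itself.

  Both faces repel the velocity. At \<open>v = 0\<close> the acceleration is at least the smaller of
  \<open>kd * \<delta>\<close> and \<open>k * ulow\<close>, hence positive (\<open>acc_pos_at_rest\<close>). At \<open>v = vbar\<close> the
  relaxation term \<open>k * (u - vbar)\<close> is negative (\<open>acc_neg_at_vbar\<close>). The acceleration is continuous
  along the trajectory because the gap is bounded
  below by \<open>\<delta> > 0\<close>, so it is the one-sided derivative of the
  velocity; its sign shows that the velocity would have been below \<open>0\<close>, respectively above \<open>vbar\<close>, shortly before
  (\<open>primitive_left_sign\<close>), which is impossible inside \<open>Xi\<close>.
\<close>

lemma closed_Xi: "closed (Xi vbar \<delta>)"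
  unfolding Xi_def case_prod_beta atLeastAtMost_iff
  by (intro closed_Collect_conj closed_Collect_le continuous_intros)

lemma interior_Xi_velocity:
  assumes "(xl, x, vl, v) \<in> interior (Xi vbar \<delta>)"
  shows "0 < v" "v < vbar"
proof -
  have "Xi vbar \<delta> \<subseteq> UNIV \<times> UNIV \<times> UNIV \<times> {0..vbar}"
    by (auto simp: Xi_def)
  from subsetD[OF interior_mono[OF this] assms]
  show "0 < v" "v < vbar"
    by (simp_all add: interior_Times)
qed

lemma interior_before_exit:
  assumes cont: "continuous_on {t0..t} z"
    and z0: "z t0 \<in> interior (Xi vbar \<delta>)"
    and t: "t0 \<le> t" "t \<le> T" "ereal t < exit_time vbar \<delta> t0 T z"
  shows "z t \<in> interior (Xi vbar \<delta>)"
proof (rule ccontr)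
  assume nin: "z t \<notin> interior (Xi vbar \<delta>)"
  have "connected (z ` {t0..t})"
    using cont by (rule connected_continuous_image) simp
  moreover have "z ` {t0..t} \<inter> interior (Xi vbar \<delta>) \<noteq> {}"
    using z0 t by force
  moreover have "z ` {t0..t} - interior (Xi vbar \<delta>) \<noteq> {}"
    using nin t by force
  ultimately have "z ` {t0..t} \<inter> frontier (interior (Xi vbar \<delta>)) \<noteq> {}"
    by (rule connected_Int_frontier)
  then obtain s where s: "s \<in> {t0..t}" and fr: "z s \<in> frontier (Xi vbar \<delta>)"
    using frontier_interior_subset by blast
  have "s \<noteq> t0"
    using z0 fr by (auto simp: frontier_def)
  then have "exit_time vbar \<delta> t0 T z \<le> ereal s"
    unfolding exit_time_def using s fr t by (intro Inf_lower) auto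
  also have "\<dots> \<le> ereal t"
    using s by simp
  finally show False
    using t by simp
qed

text \<open>
  By the fundamental theorem \<open>v\<close> has the left derivative \<open>f b\<close> at \<open>b\<close>, whose sign decides whether
  \<open>v\<close> comes from below or from above. This turns the sign of the acceleration at the exit time
  into information on the velocity just before it.
\<close>

lemma primitive_left_sign:
  fixes f v :: "real \<Rightarrow> real"
  assumes ab: "a < b"
    and f: "continuous_on {a..b} f"
    and v: "\<And>t. t \<in> {a..b} \<Longrightarrow> (f has_integral (v t - c)) {a..t}"
  shows "f b > 0 \<Longrightarrow> \<exists>s\<in>{a..<b}. v s < v b"
    and "f b < 0 \<Longrightarrow> \<exists>s\<in>{a..<b}. v b < v s"
proof -
  have v_eq: "v t = c + integral {a..t} f" if "t \<in> {a..b}" for t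
    using integral_unique[OF v[OF that]] by simp
  have "((\<lambda>t. c + integral {a..t} f) has_real_derivative f b) (at b within {a..b})"
    using integral_has_real_derivative[OF f, of b] ab by (auto intro!: derivative_eq_intros)
  then have D: "(v has_real_derivative f b) (at b within {a..b})"
    by (rule has_field_derivative_transform_within[OF _ zero_less_one]) (use ab v_eq in auto)
  have step: "\<exists>s\<in>{a..<b}. P s"
    if "d > 0" "\<And>h. 0 < h \<Longrightarrow> b - h \<in> {a..b} \<Longrightarrow> h < d \<Longrightarrow> P (b - h)" for d P
  proof -
    define h where "h = min (d / 2) (b - a)"
    have h: "0 < h" "h < d" "b - h \<in> {a..<b}"
      using ab \<open>d > 0\<close> by (auto simp: h_def min_def field_simps)
    then have "P (b - h)"
      by (intro that(2)) auto
    with h show ?thesis by blast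
  qed
  show "\<exists>s\<in>{a..<b}. v s < v b" if "f b > 0"
    using has_real_derivative_pos_inc_left[OF D that] step[of _ "\<lambda>s. v s < v b"] by blast
  show "\<exists>s\<in>{a..<b}. v b < v s" if "f b < 0"
    using has_real_derivative_neg_dec_left[OF D that] step[of _ "\<lambda>s. v b < v s"] by blast
qed

text \<open>
  With \<open>v = 0\<close> the interaction term is \<open>kv * vl / (xl - x)\<^sup>2 + kd * (xl - x)\<close>: a leader that does not
  drive backwards contributes nothing negative, and the open gap contributes the positive part.
\<close>

lemma acc_pos_at_rest:
  assumes "kv > 0" "kd > 0" "k > 0" "vl \<ge> 0" "xl - x > 0" "u > 0"
  shows "acc kv kd k \<tau>s xl x vl 0 u > 0"
  using assms by (auto simp: acc_def min_less_iff_conj intro!: add_nonneg_pos)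

text \<open>
  The minimum is at most its second argument, so the leader cannot counteract the relaxation towards
  the control, which is below \<open>vbar\<close>.
\<close>

lemma acc_neg_at_vbar:
  assumes "k > 0" "u < vbar"
  shows "acc kv kd k \<tau>s xl x vl vbar u < 0"
proof -
  have "k * (u - vbar) < 0"
    using assms by (simp add: mult_pos_neg)
  then show ?thesis
    unfolding acc_def by (rule min.strict_coboundedI2)
qed

lemma continuous_on_acc:
  assumes "continuous_on S xl" "continuous_on S x" "continuous_on S vl" "continuous_on S v"
    "continuous_on S u" and "\<And>s. s \<in> S \<Longrightarrow> xl s - x s \<noteq> 0"
  shows "continuous_on S (\<lambda>s. acc kv kd k \<tau>s (xl s) (x s) (vl s) (v s) (u s))"
  unfolding acc_def using assms by (intro continuous_intros) auto

theorem mainTheorem2: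
  fixes kv kd k \<tau>s ulow ubar vbar T \<delta> t0 xl0 x0 vl0 v0 :: real
    and u al xl x vl v :: "real \<Rightarrow> real"
    and \<tau> :: ereal
  assumes "kv > 0" "kd > 0" "k > 0" "\<tau>s > 0"
    and "0 < ulow" "ulow < ubar" "ubar < vbar"
    and "T > 0"
    and "continuous_on {0..T} u" "\<forall>t\<in>{0..T}. u t \<in> {ulow..ubar}"
    and "continuous_on {0..T} al" "\<exists>C. AE s in lebesgue_on {0..T}. \<bar>al s\<bar> \<le> C"
    and "0 < \<delta>" "\<delta> < 1"
    and "t0 \<in> {0..<T}"
    and "\<forall>t\<in>{t0..T}. 0 \<le> vl0 + integral {t0..t} al \<and> vl0 + integral {t0..t} al \<le> vbar"
    and "(xl0, x0, vl0, v0) \<in> interior (Xi vbar \<delta>)"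
    and "\<tau> = exit_time vbar \<delta> t0 T (\<lambda>t. (xl t, x t, vl t, v t))"
    and "integral_solution_on kv kd k \<tau>s u al {t \<in> {t0..T}. ereal t \<le> \<tau>} t0 (xl0, x0, vl0, v0) xl x vl v"
  shows "\<forall>t\<in>{t0..T}. ereal t \<le> \<tau> \<longrightarrow> (xl t, x t, vl t, v t) \<in> Ninv vbar \<delta>"
proof (intro ballI impI)
  fix t
  assume t: "t \<in> {t0..T}" and t\<tau>: "ereal t \<le> \<tau>"
  let ?z = "\<lambda>t. (xl t, x t, vl t, v t)"
  let ?f = "\<lambda>s. acc kv kd k \<tau>s (xl s) (x s) (vl s) (v s) (u s)"
  let ?I = "{t \<in> {t0..T}. ereal t \<le> \<tau>}"
  note sol = assms(19)[unfolded integral_solution_on_def prod.case]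
  have sub: "{t0..t} \<subseteq> ?I"
  proof
    fix s
    assume s: "s \<in> {t0..t}"
    then have "ereal s \<le> ereal t" by simp
    also note t\<tau>
    finally show "s \<in> ?I" using s t by auto
  qed
  have cont: "continuous_on {t0..t} xl" "continuous_on {t0..t} x"
    "continuous_on {t0..t} vl" "continuous_on {t0..t} v"
    using sol continuous_on_subset[OF _ sub] by blast+
  have contz: "continuous_on {t0..t} ?z"
    by (intro continuous_intros cont)
  have v_int: "(?f has_integral (v s - v0)) {t0..s}" if "s \<in> {t0..t}" for s
    using sol sub that by blast
  have "t0 \<in> ?I"
    using sub t by auto
  have point: "c = 0" if "(g has_integral c) {t0..t0}" for g :: "real \<Rightarrow> real" and c
    using that has_integral_refl(2)[of g t0] by (auto dest: has_integral_unique)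
  have "xl t0 - xl0 = 0" "x t0 - x0 = 0" "vl t0 - vl0 = 0" "v t0 - v0 = 0"
    using sol \<open>t0 \<in> ?I\<close> by (blast intro: point)+
  then have z0: "?z t0 \<in> interior (Xi vbar \<delta>)"
    using assms(17) by simp
  have inside: "?z s \<in> interior (Xi vbar \<delta>)" if "t0 \<le> s" "s \<le> t" "ereal s < \<tau>" for s
  proof -
    have "continuous_on {t0..s} ?z"
      by (rule continuous_on_subset[OF contz]) (use that in auto)
    from interior_before_exit[where z = ?z and T = T, OF this z0 that(1)] show ?thesis
      using that t assms(18) by auto
  qed
  show "?z t \<in> Ninv vbar \<delta>"
  (* the infimum defining the exit time may be t0 itself without being attained *)
  proof (cases "t = t0 \<or> ereal t < \<tau>")
    case True
    then have i: "?z t \<in> interior (Xi vbar \<delta>)"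
      using z0 inside t by auto
    then have "?z t \<in> Xi vbar \<delta>"
      using interior_subset by blast
    then show ?thesis
      using interior_Xi_velocity[OF i] by (auto simp: Ninv_def Xi_def)
  next
    case False
    then have t0t: "t0 < t"
      using t by auto
    have before: "?z s \<in> interior (Xi vbar \<delta>)" if "s \<in> {t0..<t}" for s
    proof (rule inside)
      have "ereal s < ereal t" using that by simp
      then show "ereal s < \<tau>" using t\<tau> by (rule less_le_trans)
    qed (use that in auto)
    have "?z ` closure {t0..<t} \<subseteq> Xi vbar \<delta>"
    proof (rule image_closure_subset)
      show "continuous_on (closure {t0..<t}) ?z"
        using contz t0t by simp
      show "?z ` {t0..<t} \<subseteq> Xi vbar \<delta>"
        using before interior_subset by blast
    qed (rule closed_Xi)
    then have all: "?z s \<in> Xi vbar \<delta>" if "s \<in> {t0..t}" for s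
      using that t0t by auto
    have zt: "?z t \<in> Xi vbar \<delta>"
      using all t0t by simp
    have "continuous_on {t0..t} u"
      using assms(9,15) t by (auto intro: continuous_on_subset)
    moreover have "xl s - x s \<noteq> 0" if "s \<in> {t0..t}" for s
      using all[OF that] assms(13) by (auto simp: Xi_def)
    ultimately have contf: "continuous_on {t0..t} ?f"
      using cont by (intro continuous_on_acc)
    have u: "ulow \<le> u t" "u t \<le> ubar"
      using assms(10,15) t by auto
    note left_sign = primitive_left_sign[OF t0t contf v_int]
    have "v t \<noteq> 0"
    proof
      assume v0: "v t = 0"
      have "?f t > 0"
        unfolding v0 using zt u assms(1-3,5,13) by (intro acc_pos_at_rest) (auto simp: Xi_def)
      from left_sign(1)[OF _ this] v0 obtain s where "s \<in> {t0..<t}" "v s < 0"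
        by auto
      then show False
        using interior_Xi_velocity(1)[OF before] by force
    qed
    moreover have "v t \<noteq> vbar"
    proof
      assume vb: "v t = vbar"
      have "?f t < 0"
        unfolding vb using u assms(3,7) by (intro acc_neg_at_vbar) auto
      from left_sign(2)[OF _ this] vb obtain s where "s \<in> {t0..<t}" "vbar < v s"
        by auto
      then show False
        using interior_Xi_velocity(2)[OF before] by force
    qed
    ultimately show ?thesis
      using zt by (auto simp: Ninv_def Xi_def)
  qed
qed

end
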